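(* Let $(X,\|\cdot\|)$ be a Banach space, let $b\in[0,\infty)$ and $\theta\in[0,b+1)$, and let $T:X\to X$ be a $(b,\theta)$-enriched contraction, i.e. $\|b(x-y)+Tx-Ty\|\le\theta\|x-y\|$ for all $x,y\in X$. Then: (i) $T$ has exactly one fixed point: $Fix(T)=\{p\}$ for some $p\in X$. (ii) There exists $\lambda\in(0,1]$ such that, for every $x_0\in X$, the sequence $\{x_n\}_{n=0}^\infty$ defined by $x_{n+1}=(1-\lambda)x_n+\lambda Tx_n$, $n\ge 0$, converges to $p$. (iii) For the sequences $\{x_n\}_{n=0}^\infty$ in (ii) (with that same $\lambda$ and any $x_0\in X$) the following estimate holds: $$\|x_{n+i-1}-p\|\le\frac{c^i}{1-c}\,\|x_n-x_{n-1}\|,\qquad n=1,2,\dots;\ i=1,2,\dots,$$ where $c=\dfrac{\theta}{b+1}$.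
   Context: For a mapping $T:X\to X$, $Fix(T)=\{a\in X: T(a)=a\}$. Let $(X,\|\cdot\|)$ be a linear normed space. A mapping $T:X\to X$ is called an enriched contraction if there exist $b\in[0,\infty)$ and $\theta\in[0,b+1)$ such that $\|b(x-y)+Tx-Ty\|\le\theta\|x-y\|$ for all $x,y\in X$; to indicate the constants, $T$ is called a $(b,\theta)$-enriched contraction. *)

theory Defs
  imports "HOL-Analysis.Analysis"
begin

definition Fix :: "('a \<Rightarrow> 'a) \<Rightarrow> 'a set" where
  "Fix T = {a. T a = a}"

definition enriched_contraction ::
    "real \<Rightarrow> real \<Rightarrow> ('a::real_normed_vector \<Rightarrow> 'a) \<Rightarrow> bool" where
  "enriched_contraction b \<theta> T \<longleftrightarrow>
     b \<in> {0..} \<and> \<theta> \<in> {0..<b + 1} \<and>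
     (\<forall>x y. norm (b *\<^sub>R (x - y) + T x - T y) \<le> \<theta> * norm (x - y))"

end

theory Submission
  imports Defs
begin

text \<open>
  Averaging turns an enriched contraction into an ordinary one.  With \<open>\<lambda> = 1 / (b + 1)\<close>, so that
  \<open>1 - \<lambda> = \<lambda> b\<close>, the averaged map is \<open>S x = (1 - \<lambda>) x + \<lambda> T x = \<lambda> (b x + T x)\<close>.  The enriched
  contraction inequality multiplied by \<open>\<lambda>\<close> therefore says exactly that \<open>S\<close> is Lipschitz with constant
  \<open>c = \<theta> / (b + 1) < 1\<close>.  Since \<open>\<lambda> \<noteq> 0\<close>, \<open>S\<close> and \<open>T\<close> have the same fixed points, and the Banach
  fixed point theorem for \<open>S\<close> gives exactly one.  The sequences in question are the Picard orbits
  of \<open>S\<close>; each step multiplies the distance to the fixed point \<open>p\<close> by at most \<open>c\<close>, which yields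
  convergence, and the triangle inequality for \<open>x\<close>, \<open>S x\<close>, \<open>p\<close> bounds the distance to \<open>p\<close> by the
  length of the last step.
\<close>

lemma averaged_fixed_point_iff:
  fixes T :: "'a::real_vector \<Rightarrow> 'a"
  assumes "l \<noteq> 0"
  shows "(1 - l) *\<^sub>R x + l *\<^sub>R T x = x \<longleftrightarrow> T x = x"
proof -
  have "(1 - l) *\<^sub>R x + l *\<^sub>R T x = x \<longleftrightarrow> l *\<^sub>R (T x - x) = 0"
    by (simp add: algebra_simps)
  with assms show ?thesis by simp
qed

lemma enriched_contraction_averaged:
  fixes T :: "'a::real_normed_vector \<Rightarrow> 'a"
  assumes "enriched_contraction b \<theta> T" and l: "l = 1 / (b + 1)"
  shows "dist ((1 - l) *\<^sub>R x + l *\<^sub>R T x) ((1 - l) *\<^sub>R y + l *\<^sub>R T y) \<le> \<theta> / (b + 1) * dist x y"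
proof -
  have b: "0 \<le> b" and ineq: "norm (b *\<^sub>R (x - y) + T x - T y) \<le> \<theta> * norm (x - y)"
    using assms(1) by (auto simp: enriched_contraction_def)
  have lb: "1 - l = l * b" "0 \<le> l" using b by (auto simp: l field_simps)
  have "((1 - l) *\<^sub>R x + l *\<^sub>R T x) - ((1 - l) *\<^sub>R y + l *\<^sub>R T y)
      = l *\<^sub>R (b *\<^sub>R (x - y) + T x - T y)"
    unfolding lb(1) by (simp add: algebra_simps)
  then have "dist ((1 - l) *\<^sub>R x + l *\<^sub>R T x) ((1 - l) *\<^sub>R y + l *\<^sub>R T y)
      = l * norm (b *\<^sub>R (x - y) + T x - T y)"
    using lb(2) by (simp add: dist_norm)
  also have "\<dots> \<le> l * (\<theta> * norm (x - y))"
    using ineq lb(2) by (rule mult_left_mono)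
  also have "\<dots> = \<theta> / (b + 1) * dist x y"
    by (simp add: l dist_norm)
  finally show ?thesis .
qed

text \<open>
  Convergence and the error estimate only compare points of an orbit with \<open>p\<close>, so a map that
  contracts towards the single point \<open>p\<close> suffices for both.
\<close>

lemma orbit_dist_le:
  fixes S :: "'a::metric_space \<Rightarrow> 'a"
  assumes contr: "\<And>z. dist (S z) p \<le> c * dist z p" and "0 \<le> c"
    and orbit: "\<And>n. x (Suc n) = S (x n)"
  shows "dist (x (n + k)) p \<le> c ^ k * dist (x n) p"
proof (induction k)
  case (Suc k)
  have "dist (x (n + Suc k)) p \<le> c * dist (x (n + k)) p"
    using contr orbit by simp
  also have "\<dots> \<le> c * (c ^ k * dist (x n) p)"
    using Suc.IH \<open>0 \<le> c\<close> by (rule mult_left_mono)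
  finally show ?case by (simp add: mult.assoc)
qed simp

lemma orbit_tendsto:
  fixes S :: "'a::metric_space \<Rightarrow> 'a"
  assumes contr: "\<And>z. dist (S z) p \<le> c * dist z p" and "0 \<le> c" "c < 1"
    and orbit: "\<And>n. x (Suc n) = S (x n)"
  shows "x \<longlonglongrightarrow> p"
proof -
  have "(\<lambda>n. c ^ n * dist (x 0) p) \<longlonglongrightarrow> 0"
    using \<open>0 \<le> c\<close> \<open>c < 1\<close> by (auto intro: tendsto_mult_left_zero[OF LIMSEQ_power_zero])
  then have "(\<lambda>n. dist (x n) p) \<longlonglongrightarrow> 0"
  proof (rule Lim_null_comparison[rotated])
    show "\<forall>\<^sub>F n in sequentially. norm (dist (x n) p) \<le> c ^ n * dist (x 0) p"
      using orbit_dist_le[where S = S and x = x and n = 0, OF contr \<open>0 \<le> c\<close> orbit] by simp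
  qed
  then show ?thesis by (rule iffD2[OF tendsto_dist_iff])
qed

text \<open>
  From \<open>dist (S z) p \<le> c * dist z p \<le> c * (dist z (S z) + dist (S z) p)\<close>, collecting the terms
  with \<open>dist (S z) p\<close>.
\<close>

lemma dist_image_le_step:
  fixes S :: "'a::metric_space \<Rightarrow> 'a"
  assumes contr: "dist (S z) p \<le> c * dist z p" and "0 \<le> c" "c < 1"
  shows "dist (S z) p \<le> c / (1 - c) * dist (S z) z"
proof -
  have "c * dist z p \<le> c * (dist (S z) z + dist (S z) p)"
    using \<open>0 \<le> c\<close> by (intro mult_left_mono) (simp_all add: dist_triangle3)
  with contr have "(1 - c) * dist (S z) p \<le> c * dist (S z) z"
    by (simp add: algebra_simps)
  then show ?thesis using \<open>c < 1\<close> by (simp add: field_simps)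
qed

text \<open>
  The step from \<open>x (n - 1)\<close> to \<open>x n\<close> bounds the error of \<open>x n\<close> and contributes one factor \<open>c\<close>;
  the other \<open>i - 1\<close> factors come from the iterations leading from \<open>x n\<close> to \<open>x (n + i - 1)\<close>.
\<close>

lemma orbit_error_estimate:
  fixes S :: "'a::metric_space \<Rightarrow> 'a"
  assumes contr: "\<And>z. dist (S z) p \<le> c * dist z p" and c: "0 \<le> c" "c < 1"
    and orbit: "\<And>n. x (Suc n) = S (x n)"
    and "n \<ge> 1" "i \<ge> 1"
  shows "dist (x (n + i - 1)) p \<le> c ^ i / (1 - c) * dist (x n) (x (n - 1))"
proof -
  obtain m j where n: "n = Suc m" and i: "i = Suc j"
    using \<open>n \<ge> 1\<close> \<open>i \<ge> 1\<close> by (cases n; cases i; simp)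
  have "dist (x (n + j)) p \<le> c ^ j * dist (x n) p"
    using contr c(1) orbit by (rule orbit_dist_le[where S = S and x = x])
  also have "\<dots> \<le> c ^ j * (c / (1 - c) * dist (x n) (x m))"
    using dist_image_le_step[where S = S and z = "x m", OF contr c] c(1)
    by (intro mult_left_mono) (simp_all add: n orbit)
  finally show ?thesis by (simp add: n i mult_ac)
qed

theorem theorem1:
  fixes T :: "'a::banach \<Rightarrow> 'a" and b \<theta> :: real
  assumes "enriched_contraction b \<theta> T"
  shows "\<exists>p. Fix T = {p} \<and>
    (\<exists>l\<in>{0<..1::real}. \<forall>x0. \<forall>x :: nat \<Rightarrow> 'a.
       x 0 = x0 \<longrightarrow> (\<forall>n. x (Suc n) = (1 - l) *\<^sub>R x n + l *\<^sub>R T (x n)) \<longrightarrow>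
         x \<longlonglongrightarrow> p \<and>
         (let c = \<theta> / (b + 1) in
           \<forall>n\<ge>1. \<forall>i\<ge>1. norm (x (n + i - 1) - p) \<le> c ^ i / (1 - c) * norm (x n - x (n - 1))))"
proof -
  define l where "l = 1 / (b + 1)"
  define c where "c = \<theta> / (b + 1)"
  define S where "S x = (1 - l) *\<^sub>R x + l *\<^sub>R T x" for x
  have "0 \<le> b" "0 \<le> \<theta>" "\<theta> < b + 1"
    using assms by (auto simp: enriched_contraction_def)
  then have l: "l \<in> {0<..1}" and c: "0 \<le> c" "c < 1"
    by (auto simp: l_def c_def)
  have lip: "dist (S x) (S y) \<le> c * dist x y" for x y
    unfolding S_def c_def using assms l_def by (rule enriched_contraction_averaged)
  have fix_iff: "S x = x \<longleftrightarrow> T x = x" for x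
    unfolding S_def using l by (intro averaged_fixed_point_iff) simp
  have "\<exists>!x. S x = x"
    using c lip by (intro banach_fix_type) auto
  then obtain p where p: "S p = p" and uniq: "\<And>q. S q = q \<Longrightarrow> q = p"
    by auto
  have contr: "dist (S z) p \<le> c * dist z p" for z
    using lip[of z p] by (simp add: p)
  have Fix: "Fix T = {p}"
    unfolding Fix_def fix_iff[symmetric] using p uniq by blast
  have orbits: "x \<longlonglongrightarrow> p \<and> (\<forall>n\<ge>1. \<forall>i\<ge>1.
      norm (x (n + i - 1) - p) \<le> c ^ i / (1 - c) * norm (x n - x (n - 1)))"
    if "\<forall>n. x (Suc n) = (1 - l) *\<^sub>R x n + l *\<^sub>R T (x n)" for x
  proof -
    have orbit: "x (Suc n) = S (x n)" for n
      unfolding S_def using that by (rule spec)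
    show ?thesis
      unfolding dist_norm[symmetric]
      using orbit_tendsto[where S = S and x = x, OF contr c orbit]
        orbit_error_estimate[where S = S and x = x, OF contr c orbit]
      by blast
  qed
  show ?thesis
    unfolding Let_def c_def[symmetric]
    by (intro exI[of _ p] conjI[OF Fix] bexI[OF _ l] allI impI) (rule orbits)
qed

end
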